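(* Let $F(w)=wP(w)/Q(w)\in\mathcal{F}$. If $(w_0,z_0)\in\mathbb{C}^2$ satisfies \[ w_0P(w_0)=z_0Q(w_0),\qquad P(w_0)+w_0P'(w_0)=z_0Q'(w_0), \] then $w_0$ is a root of the polynomial \[ \chi_F(w):=\big(P(w)+wP'(w)\big)Q(w)-wP(w)Q'(w). \] Consequently, if $\chi_F(w)$ has only real roots then the sequence $(s_n(F))_{n\ge0}$ is positive definite.
   Context: $\mathcal{F}$ is the set of rational functions $F(w)=wP(w)/Q(w)$, where $P,Q\in\mathbb{R}[w]$ are relatively prime polynomials with $P(0)=Q(0)=1$. For $F\in\mathcal{F}$ let $D(z)=z\sum_{n\ge0}s_n(F)z^n$ be the compositional inverse of $F$ near $0$ (so $F(D(z))=z$, $D(0)=0$, $s_0(F)=1$). The sequence $(s_n(F))_{n\ge0}$ is called positive definite if there is a probability distribution $\mu$ on $\mathbb{R}$ with $s_n(F)=\int_{\mathbb{R}}x^n\,\mu(dx)$ for all $n\ge 0$. *)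

theory Defs
  imports "HOL-Probability.Probability" "HOL-Complex_Analysis.Complex_Analysis"
    "HOL-Computational_Algebra.Computational_Algebra"
begin

abbreviation cpoly :: "real poly \<Rightarrow> complex \<Rightarrow> complex" where
  "cpoly p \<equiv> poly (map_poly complex_of_real p)"

text \<open>
  A rational function \<open>F(w) = w P(w) / Q(w)\<close> of the class is represented by the pair
  \<open>(P, Q)\<close>, which is uniquely determined by \<open>F\<close> because of the normalisation at 0.
\<close>

definition admissible :: "real poly \<Rightarrow> real poly \<Rightarrow> bool" where
  "admissible P Q \<longleftrightarrow> coprime P Q \<and> poly P 0 = 1 \<and> poly Q 0 = 1"

definition F_fps :: "real poly \<Rightarrow> real poly \<Rightarrow> real fps" where
  "F_fps P Q = fps_X * fps_of_poly P / fps_of_poly Q"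

text \<open>
  \<open>s_seq P Q n\<close> is \<open>s\<^sub>n(F)\<close>, where \<open>D(z) = z (\<Sum>n. s\<^sub>n(F) z\<^sup>n)\<close> is the compositional inverse of
  the Taylor series of \<open>F\<close> at 0, hence the index shift. Lemmas \<open>s_seq_inverse\<close> and
  \<open>s_seq_analytic_inverse\<close> below confirm that this is the inverse of \<open>F\<close> near 0, formally and
  analytically.
\<close>

definition s_seq :: "real poly \<Rightarrow> real poly \<Rightarrow> nat \<Rightarrow> real" where
  "s_seq P Q n = fps_nth (fps_inv (F_fps P Q)) (Suc n)"

definition chi :: "real poly \<Rightarrow> real poly \<Rightarrow> real poly" where
  "chi P Q = (P + [:0, 1:] * pderiv P) * Q - [:0, 1:] * P * pderiv Q"

text \<open>
  Integrability is required explicitly, since the Bochner integral of a non-integrable function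
  is 0 by convention.
\<close>

definition positive_definite_seq :: "(nat \<Rightarrow> real) \<Rightarrow> bool" where
  "positive_definite_seq s \<longleftrightarrow>
     (\<exists>\<mu>. real_distribution \<mu> \<and>
        (\<forall>n. integrable \<mu> (\<lambda>x. x ^ n) \<and> s n = (LINT x|\<mu>. x ^ n)))"

lemma F_fps_mult: "admissible P Q \<Longrightarrow> F_fps P Q * fps_of_poly Q = fps_X * fps_of_poly P"
  unfolding F_fps_def admissible_def
  by (subst fps_divide_unit) (auto simp: poly_0_coeff_0 mult.assoc inverse_mult_eq_1)

lemma F_fps_nth_0: "admissible P Q \<Longrightarrow> fps_nth (F_fps P Q) 0 = 0"
  using arg_cong[OF F_fps_mult, of P Q "\<lambda>f. fps_nth f 0"]
  by (simp add: poly_0_coeff_0 admissible_def)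

lemma F_fps_nth_1: "admissible P Q \<Longrightarrow> fps_nth (F_fps P Q) 1 = 1"
  using arg_cong[OF F_fps_mult, of P Q "\<lambda>f. fps_nth f 1"] F_fps_nth_0[of P Q]
  by (simp add: poly_0_coeff_0 admissible_def fps_mult_nth_1)

lemma s_seq_fps: "fps_X * Abs_fps (s_seq P Q) = fps_inv (F_fps P Q)"
  by (rule fps_ext) (auto simp: s_seq_def fps_inv_def gr0_conv_Suc)

lemma s_seq_inverse:
  assumes "admissible P Q"
  shows "F_fps P Q oo (fps_X * Abs_fps (s_seq P Q)) = fps_X" and "s_seq P Q 0 = 1"
proof -
  show "F_fps P Q oo (fps_X * Abs_fps (s_seq P Q)) = fps_X"
    unfolding s_seq_fps using F_fps_nth_0[OF assms] F_fps_nth_1[OF assms]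
    by (intro fps_inv_right) auto
  show "s_seq P Q 0 = 1"
    using F_fps_nth_1[OF assms] by (simp add: s_seq_def fps_inv_def)
qed

definition fps_complex :: "real fps \<Rightarrow> complex fps" where
  "fps_complex f = Abs_fps (\<lambda>n. of_real (fps_nth f n))"

lemma fps_complex_nth [simp]: "fps_nth (fps_complex f) n = of_real (fps_nth f n)"
  by (simp add: fps_complex_def)

lemma fps_complex_mult: "fps_complex (f * g) = fps_complex f * fps_complex g"
  by (rule fps_ext) (simp add: fps_mult_nth)

lemma fps_complex_X [simp]: "fps_complex fps_X = fps_X"
  by (rule fps_ext) (simp add: fps_X_def)

lemma fps_complex_power: "fps_complex (f ^ n) = fps_complex f ^ n"
proof (induction n)
  case 0
  show ?case by (rule fps_ext) simp
qed (simp add: fps_complex_mult)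

lemma fps_complex_compose: "fps_complex (f oo g) = fps_complex f oo fps_complex g"
  by (rule fps_ext) (simp add: fps_compose_nth flip: fps_complex_power)

lemma fps_complex_of_poly: "fps_complex (fps_of_poly p) = fps_of_poly (map_poly of_real p)"
  by (rule fps_ext) (simp add: coeff_map_poly)

lemma has_fps_expansion_poly:
  fixes p :: "complex poly"
  shows "poly p has_fps_expansion fps_of_poly p"
proof (induction p)
  case (pCons a p)
  have "(\<lambda>x. a + x * poly p x) has_fps_expansion fps_const a + fps_X * fps_of_poly p"
    by (intro fps_expansion_intros pCons.IH)
  then show ?case
    by (simp add: fps_of_poly_pCons mult.commute add.commute)
qed simp

lemma s_seq_analytic_inverse:
  fixes D :: "complex \<Rightarrow> complex"
  assumes "admissible P Q"
    and "D analytic_on {0}" and "D 0 = 0"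
    and inv: "\<forall>\<^sub>F z in nhds 0. D z * cpoly P (D z) / cpoly Q (D z) = z"
  shows "D has_fps_expansion fps_X * Abs_fps (\<lambda>n. complex_of_real (s_seq P Q n))"
proof -
  define G where "G = fps_expansion D 0"
  have G: "D has_fps_expansion G"
    unfolding G_def by (intro analytic_at_imp_has_fps_expansion_0 assms)
  have G0: "fps_nth G 0 = 0"
    using has_fps_expansion_imp_0_eq_fps_nth_0[OF G] assms(3) by simp
  let ?F = "fps_complex (F_fps P Q)"
  let ?P = "map_poly complex_of_real P" and ?Q = "map_poly complex_of_real Q"
  have Q0: "fps_nth (fps_of_poly ?Q) 0 = 1"
    using assms(1) by (simp add: admissible_def poly_0_coeff_0 coeff_map_poly)
  then have Qnz: "fps_of_poly ?Q \<noteq> 0" by auto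
  have "?F * fps_of_poly ?Q = fps_X * fps_of_poly ?P"
    using arg_cong[OF F_fps_mult[OF assms(1)], of fps_complex]
    by (simp add: fps_complex_mult fps_complex_of_poly)
  then have Feq: "?F = fps_X * fps_of_poly ?P / fps_of_poly ?Q"
    using Qnz by (metis nonzero_mult_div_cancel_right)
  have "(\<lambda>w. w * poly ?P w / poly ?Q w) has_fps_expansion ?F"
    unfolding Feq using Q0 by (intro fps_expansion_intros has_fps_expansion_poly) auto
  from has_fps_expansion_compose[OF this G G0]
  have "(\<lambda>z. D z * poly ?P (D z) / poly ?Q (D z)) has_fps_expansion (?F oo G)"
    by (simp add: o_def)
  also have "?this \<longleftrightarrow> (\<lambda>z. z) has_fps_expansion (?F oo G)"
    by (intro has_fps_expansion_cong inv refl)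
  finally have 1: "?F oo G = fps_X"
    using fps_expansion_unique_complex has_fps_expansion_fps_X by blast
  have F0: "fps_nth ?F 0 = 0" and F1: "fps_nth ?F 1 \<noteq> 0"
    using F_fps_nth_0[OF assms(1)] F_fps_nth_1[OF assms(1)] by auto
  let ?H = "fps_complex (fps_X * Abs_fps (s_seq P Q))"
  have 2: "?F oo ?H = fps_X"
    by (simp flip: fps_complex_compose add: s_seq_inverse[OF assms(1)])
  have eq: "K = fps_inv ?F" if K: "?F oo K = fps_X" "fps_nth K 0 = 0" for K
  proof -
    have "fps_inv ?F oo (?F oo K) = (fps_inv ?F oo ?F) oo K"
      by (rule fps_compose_assoc) (use K F0 in auto)
    then show ?thesis
      using K fps_inv[OF F0 F1] by (simp add: fps_X_fps_compose_startby0)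
  qed
  have "G = ?H"
    using eq[OF 1 G0] eq[OF 2] by simp
  also have "?H = fps_X * Abs_fps (\<lambda>n. complex_of_real (s_seq P Q n))"
    unfolding fps_complex_mult fps_complex_X by (simp add: fps_complex_def)
  finally show ?thesis using G by simp
qed

end

theory Submission
  imports Defs "HOL-Real_Asymp.Real_Asymp" "HOL-Computational_Algebra.Field_as_Ring"
begin

text \<open>
  Since \<open>F' = \<chi>\<^sub>F / Q\<^sup>2\<close>, all critical points and hence all critical values of \<open>F\<close> are real.
  So \<open>F\<close> is a covering over the upper half-plane, the local inverse \<open>D\<close> extends to it, and
  \<open>D\<close> cannot take real values there because \<open>F\<close> is real on the real line: \<open>D\<close> maps the upper
  half-plane to itself. By reflection, \<open>D\<close> is holomorphic on a plane slit along
  \<open>\<bar>x\<bar> \<ge> \<rho>\<close>; rescale to \<open>\<rho> = 1\<close>.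

  The map \<open>u \<mapsto> 2 u / (1 + u\<^sup>2)\<close> takes the unit disc to that slit plane and preserves the sign of
  the imaginary part, so \<open>g(u) = D(2 u / (1 + u\<^sup>2)) / 2 = \<Sum> a\<^sub>k u\<^sup>k\<close> has nonnegative imaginary part on
  the upper half-disc. The densities \<open>2 / (\<pi> r) Im g(r e\<^sup>i\<^sup>t) sin t\<close> on \<open>[0, \<pi>]\<close>, pushed forward by
  \<open>cos\<close>, are probability measures on \<open>[-1, 1]\<close> whose integrals of the Chebyshev polynomials
  \<open>U\<^sub>k\<close> are \<open>a\<^sub>k\<^sub>+\<^sub>1 r\<^sup>k\<close>. A weak limit as \<open>r \<rightarrow> 1\<close> has the required moments, because the generating
  functions of moments and of Chebyshev moments differ by the same substitution
  \<open>2 u / (1 + u\<^sup>2)\<close>.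
\<close>

section \<open>Measures from functions with nonnegative imaginary part on the upper half-disc\<close>

text \<open>A common compact support gives tightness, hence a weakly convergent subsequence. Values
  outside the interval are invisible to all the measures, so convergence extends from bounded to
  arbitrary continuous functions.\<close>

lemma bounded_support_weak_limit:
  fixes \<mu> :: "nat \<Rightarrow> real measure" and a b :: real
  assumes dist: "\<And>n. real_distribution (\<mu> n)"
    and supp: "\<And>n. AE x in \<mu> n. x \<in> {a..b}" and "a \<le> b"
  obtains r M where "strict_mono (r :: nat \<Rightarrow> nat)" "real_distribution M"
    "AE x in M. x \<in> {a..b}"
    "\<And>f :: real \<Rightarrow> real. continuous_on UNIV f \<Longrightarrow>
       (\<lambda>n. integral\<^sup>L (\<mu> (r n)) f) \<longlonglongrightarrow> integral\<^sup>L M f"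
proof -
  have "tight \<mu>"
    unfolding tight_def
  proof (intro conjI allI impI)
    fix \<epsilon> :: real assume "\<epsilon> > 0"
    \<comment> \<open>Tightness is stated with half-open intervals, so the left end moves to
      \<open>a - 1\<close> to keep a possible atom at \<open>a\<close>.\<close>
    have "measure (\<mu> n) {a - 1<..b} = 1" for n
    proof -
      interpret real_distribution "\<mu> n" by (rule dist)
      show ?thesis
        using supp[of n] by (subst prob_eq_1) (auto elim!: AE_mp)
    qed
    then show "\<exists>a b. a < b \<and> (\<forall>n. measure (\<mu> n) {a<..b} > 1 - \<epsilon>)"
      using \<open>a \<le> b\<close> \<open>\<epsilon> > 0\<close> by (intro exI[of _ "a - 1"] exI[of _ b]) auto
  qed (rule dist)
  from tight_imp_convergent_subsubsequence[OF this strict_mono_id]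
  obtain r M where r: "strict_mono r" and M: "real_distribution M"
    and conv: "weak_conv_m (\<mu> \<circ> r) M"
    by auto
  interpret M: real_distribution M by (rule M)
  have lim: "(\<lambda>n. integral\<^sup>L (\<mu> (r n)) f) \<longlonglongrightarrow> integral\<^sup>L M f"
    if "continuous_on UNIV f" "\<And>x. norm (f x) \<le> B" for f :: "real \<Rightarrow> real" and B
    using weak_conv_imp_integral_bdd_continuous_conv[of "\<mu> \<circ> r" M f B] dist M conv that
    by (auto simp: continuous_on_eq_continuous_at)
  have suppM: "AE x in M. x \<in> {a..b}"
  proof -
    \<comment> \<open>The distance to \<open>{a..b}\<close> cut off at 1: a bounded continuous test
      function whose zero set is exactly the interval.\<close>
    define d where "d x = min 1 (max 0 (max (a - x) (x - b)))" for x :: real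
    have d: "continuous_on UNIV d" "\<And>x. norm (d x) \<le> 1" "\<And>x. d x \<ge> 0"
      unfolding d_def by (auto intro!: continuous_intros)
    have [measurable]: "d \<in> borel_measurable borel"
      using d by (intro borel_measurable_continuous_onI) auto
    have d0: "d x = 0 \<longleftrightarrow> x \<in> {a..b}" for x
      using \<open>a \<le> b\<close> by (auto simp: d_def min_def max_def)
    have "integral\<^sup>L (\<mu> n) d = 0" for n
    proof -
      interpret real_distribution "\<mu> n" by (rule dist)
      have "integral\<^sup>L (\<mu> n) d = integral\<^sup>L (\<mu> n) (\<lambda>_. 0)"
        using supp[of n] by (intro integral_cong_AE) (auto simp: d0)
      then show ?thesis by simp
    qed
    with lim[OF d(1,2)] have "integral\<^sup>L M d = 0"
      by (simp add: LIMSEQ_const_iff)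
    moreover have "integrable M d"
      by (rule M.integrable_const_bound[of _ 1]) (use d in auto)
    ultimately have "AE x in M. d x = 0"
      using d(3) by (subst (asm) integral_nonneg_eq_0_iff_AE) auto
    then show ?thesis by (simp add: d0)
  qed
  have "(\<lambda>n. integral\<^sup>L (\<mu> (r n)) f) \<longlonglongrightarrow> integral\<^sup>L M f"
    if f: "continuous_on UNIV f" for f :: "real \<Rightarrow> real"
  proof -
    \<comment> \<open>Clamping the argument to the interval makes \<open>f\<close> bounded and
      changes it only on null sets.\<close>
    let ?f = "\<lambda>x. f (max a (min b x))"
    have [measurable]: "f \<in> borel_measurable borel"
      using f by (intro borel_measurable_continuous_onI) auto
    have "compact (f ` {a..b})"
      by (intro compact_continuous_image continuous_on_subset[OF f]) auto
    then obtain B where B: "\<And>x. x \<in> {a..b} \<Longrightarrow> norm (f x) \<le> B"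
      by (meson bounded_iff compact_imp_bounded image_eqI)
    have eq: "integral\<^sup>L N ?f = integral\<^sup>L N f"
      if "AE x in N. x \<in> {a..b}" "real_distribution N" for N
    proof -
      interpret N: real_distribution N by fact
      show ?thesis using that(1)
        by (intro integral_cong_AE) (auto elim!: AE_mp)
    qed
    have "(\<lambda>n. integral\<^sup>L (\<mu> (r n)) ?f) \<longlonglongrightarrow> integral\<^sup>L M ?f"
      using \<open>a \<le> b\<close> by (intro lim[of _ B] B continuous_on_compose2[OF f] continuous_intros) auto
    then show ?thesis
      unfolding eq[OF supp dist] eq[OF suppM M] .
  qed
  with that r M suppM show thesis by blast
qed

section \<open>Orthogonality of sines and coefficients of sine series\<close>

lemma integral_sin_sin:
  fixes j k :: nat
  assumes "j > 0" "k > 0"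
  shows "(LINT t|lborel. (sin (real k * t) * sin (real j * t)) * indicator {0..pi} t) = (if k = j then pi / 2 else 0)"
proof -
  \<comment> \<open>Antiderivative from the product-to-sum formula. For \<open>k = j\<close> the
    difference frequency is 0, so its cosine is the constant 1 and contributes
    \<open>t / 2\<close>.\<close>
  define F where "F t = (if k = j then t / 2 - sin ((2 * real k) * t) / (2 * (2 * real k))
    else sin ((real k - j) * t) / (2 * (real k - j)) - sin ((real k + j) * t) / (2 * (real k + j)))" for t :: real
  have "(LINT t|lborel. (sin (real k * t) * sin (real j * t)) * indicator {0..pi} t) = F pi - F 0"
  proof (rule integral_FTC_Icc_real)
    fix t :: real
    have s: "sin (real k * t) * sin (real j * t) = (cos ((real k - j) * t) - cos ((real k + j) * t)) / 2"
      by (simp add: left_diff_distrib distrib_right cos_diff cos_add)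
    have D: "DERIV (\<lambda>t. sin (c * t) / (2 * c)) t :> cos (c * t) / 2" if "c \<noteq> 0" for c :: real
      using that by (auto intro!: derivative_eq_intros)
    show "DERIV F t :> sin (real k * t) * sin (real j * t)"
    proof (cases "k = j")
      case True
      have "DERIV (\<lambda>t. t / 2 - sin ((2 * real k) * t) / (2 * (2 * real k))) t :> 1 / 2 - cos ((2 * real k) * t) / 2"
        using assms by (intro DERIV_diff D DERIV_cdivide DERIV_ident) auto
      with True show ?thesis
        unfolding s by (simp add: F_def[abs_def] diff_divide_distrib)
    next
      case False
      have "DERIV (\<lambda>t. sin ((real k - j) * t) / (2 * (real k - j)) - sin ((real k + j) * t) / (2 * (real k + j))) t
         :> cos ((real k - j) * t) / 2 - cos ((real k + j) * t) / 2"
        using assms False by (intro DERIV_diff D) auto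
      with False show ?thesis
        unfolding s by (simp add: F_def[abs_def] diff_divide_distrib)
    qed
  qed (auto intro!: continuous_intros)
  moreover have "sin ((real k - j) * pi) = 0" "sin ((real k + j) * pi) = 0" "sin (2 * real k * pi) = 0"
    using sin_npi_int[of "int k - int j"] sin_npi_int[of "int k + int j"] sin_npi_int[of "2 * int k"]
    by (simp_all add: mult.commute)
  ultimately show ?thesis by (simp add: F_def)
qed

text \<open>Absolute summability dominates the series on the interval, so it may be integrated term
  by term; orthogonality then leaves only the term \<open>k = j\<close>.\<close>

lemma sine_coefficient_integral:
  fixes b :: "nat \<Rightarrow> real"
  assumes b: "summable (\<lambda>k. \<bar>b k\<bar>)" and "j > 0"
  defines "f \<equiv> \<lambda>t::real. (\<Sum>k. b k * sin (real k * t)) * sin (real j * t) * indicator {0..pi} t"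
  shows "integrable lborel f" and "integral\<^sup>L lborel f = pi / 2 * b j"
proof -
  define F where "F k t = b k * ((sin (real k * t) * sin (real j * t)) * indicator {0..pi} t)" for k and t :: real
  have sm: "summable (\<lambda>k. b k * sin (real k * t))" for t
    by (rule summable_norm_cancel, rule summable_comparison_test'[OF b])
       (auto simp: abs_mult intro: mult_left_le)
  have f: "f t = (\<Sum>k. F k t)" for t
  proof -
    have "(\<lambda>k. F k t) = (\<lambda>k. b k * sin (real k * t) * (sin (j * t) * indicator {0..pi} t))"
      by (simp add: F_def mult_ac)
    then have F: "(\<Sum>k. F k t) = (\<Sum>k. b k * sin (real k * t)) * (sin (real j * t) * indicator {0..pi} t)"
      by (simp only: suminf_mult2[OF sm])
    have "f t = (\<Sum>k. b k * sin (real k * t)) * (sin (real j * t) * indicator {0..pi} t)"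
      by (simp add: f_def mult.assoc)
    with F show ?thesis by simp
  qed
  have int: "integrable lborel (F k)" for k
    unfolding F_def by (intro integrable_mult_right borel_integrable_atLeastAtMost) auto
  have bd: "norm (F k t) \<le> \<bar>b k\<bar> * indicator {0..pi} t" for k t
    by (auto simp: F_def abs_mult indicator_def intro!: mult_left_le mult_le_one)
  have "AE t in lborel. summable (\<lambda>k. norm (F k t))"
  proof (intro AE_I2)
    fix t show "summable (\<lambda>k. norm (F k t))"
      by (rule summable_comparison_test'[where N = 0 and g = "\<lambda>k. \<bar>b k\<bar> * indicator {0..pi} t"])
         (use bd[of _ t] in \<open>auto intro!: summable_mult2 b\<close>)
  qed
  moreover have "summable (\<lambda>k. LINT t|lborel. norm (F k t))"
  proof (rule summable_comparison_test'[where N = 0 and g = "\<lambda>k. \<bar>b k\<bar> * pi"])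
    fix k
    have "(LINT t|lborel. norm (F k t)) \<le> (LINT t|lborel. \<bar>b k\<bar> * indicator {0..pi} t)"
      using bd by (intro integral_mono integrable_norm int) auto
    then show "norm (LINT t|lborel. norm (F k t)) \<le> \<bar>b k\<bar> * pi"
      by simp
  qed (intro summable_mult2 b)
  ultimately have *: "integrable lborel (\<lambda>t. \<Sum>k. F k t)"
    "(\<lambda>k. integral\<^sup>L lborel (F k)) sums (\<integral>t. (\<Sum>k. F k t) \<partial>lborel)"
    by (rule integrable_suminf[OF int] sums_integral[OF int]; assumption)+
  have f_eq: "f = (\<lambda>t. \<Sum>k. F k t)"
    by (rule ext) (rule f)
  show "integrable lborel f"
    unfolding f_eq by (rule *)
  \<comment> \<open>The orthogonality relation assumes a positive frequency; the term
    \<open>k = 0\<close> vanishes because \<open>sin 0 = 0\<close>.\<close>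
  have "integral\<^sup>L lborel (F k) = (if k = j then pi / 2 * b j else 0)" for k
    unfolding F_def using integral_sin_sin[of j k] \<open>j > 0\<close> by (cases "k = 0") auto
  then have "(\<lambda>k. integral\<^sup>L lborel (F k)) sums (pi / 2 * b j)"
    using sums_single[of j "\<lambda>_. pi / 2 * b j"] by simp
  from sums_unique2[OF *(2) this] show "integral\<^sup>L lborel f = pi / 2 * b j"
    unfolding f_eq .
qed

text \<open>Because the coefficients are real, \<open>Im g\<close> on the circle of radius
  \<open>r\<close> is the sine series with coefficients \<open>a k * r ^ k\<close>. The factor
  \<open>sin t\<close> in the density turns \<open>q k (cos t)\<close> into
  \<open>sin (k * t)\<close>, so integrals of \<open>q k\<close> are sine coefficients. Dividing by
  \<open>r\<close> lowers the exponent by one and gives total mass \<open>a 1 = 1\<close>.\<close>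

lemma typically_real_circle_distribution:
  fixes a :: "nat \<Rightarrow> real" and g :: "complex \<Rightarrow> complex" and q :: "nat \<Rightarrow> real \<Rightarrow> real"
  assumes g: "\<And>u. norm u < 1 \<Longrightarrow> (\<lambda>k. of_real (a k) * u ^ k) sums g u"
    and pos: "\<And>u. norm u < 1 \<Longrightarrow> Im u > 0 \<Longrightarrow> Im (g u) \<ge> 0"
    and a1: "a 1 = 1"
    and q: "\<And>k t. q k (cos t) * sin t = sin (k * t)" "\<And>k. continuous_on UNIV (q k)"
    and r: "0 < r" "r < 1"
  obtains \<mu> where "real_distribution \<mu>" "AE x in \<mu>. x \<in> {-1..1}"
    "\<And>k. (LINT x|\<mu>. q (Suc k) x) = a (Suc k) * r ^ k"
proof -
  define h where "h t = (\<Sum>k. a k * r ^ k * sin (real k * t))" for t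
  define w where "w t = 2 / (pi * r) * (h t * sin t * indicator {0..pi} t)" for t
  have abssum: "summable (\<lambda>k. \<bar>a k * r ^ k\<bar>)"
  proof -
    \<comment> \<open>Convergence at a radius strictly between \<open>r\<close> and 1 yields
      absolute convergence at \<open>r\<close>.\<close>
    define s where "s = (1 + r) / 2"
    have s: "r < s" "s < 1" using r by (auto simp: s_def)
    have "summable (\<lambda>k. complex_of_real (a k) * of_real s ^ k)"
      using g[of "of_real s"] s r by (auto simp: summable_def)
    then have "summable (\<lambda>k. norm (of_real (a k) * complex_of_real r ^ k))"
      by (rule powser_insidea) (use s r in auto)
    then show ?thesis by (simp add: norm_mult norm_power abs_mult power_abs)
  qed
  have h: "h t = Im (g (of_real r * cis t))" for t
  proof -
    have "(\<lambda>k. of_real (a k) * (of_real r * cis t) ^ k) sums g (of_real r * cis t)"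
      using r by (intro g) (auto simp: norm_mult)
    from sums_Im[OF this] show ?thesis
      by (simp add: h_def sums_iff power_mult_distrib Complex.DeMoivre mult_ac flip: of_real_power)
  qed
  \<comment> \<open>For \<open>t\<close> strictly between 0 and \<open>pi\<close> the point on the
    circle lies in the upper half-disc; at both ends \<open>sin t\<close> vanishes.\<close>
  have w0: "w t \<ge> 0" for t
  proof (cases "0 < t \<and> t < pi")
    case True
    then have "sin t > 0" by (intro sin_gt_zero) auto
    moreover have "h t \<ge> 0"
      unfolding h using r \<open>sin t > 0\<close> by (intro pos) (auto simp: norm_mult)
    ultimately show ?thesis using r by (simp add: w_def)
  qed (auto simp: w_def indicator_def)
  have w: "integrable lborel (\<lambda>t. w t * q (Suc k) (cos t))"
    "(LINT t|lborel. w t * q (Suc k) (cos t)) = a (Suc k) * r ^ k" for k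
  proof -
    have *: "w t * q (Suc k) (cos t) = 2 / (pi * r) * (h t * sin (real (Suc k) * t) * indicator {0..pi} t)" for t
      unfolding w_def q(1)[of "Suc k" t, symmetric] by (simp add: mult_ac)
    show "integrable lborel (\<lambda>t. w t * q (Suc k) (cos t))"
      unfolding * h_def
      by (intro integrable_mult_right sine_coefficient_integral(1)[OF abssum]) auto
    show "(LINT t|lborel. w t * q (Suc k) (cos t)) = a (Suc k) * r ^ k"
      unfolding * h_def integral_mult_right_zero
      by (subst sine_coefficient_integral(2)[OF abssum]) (use r in auto)
  qed
  have w1: "integrable lborel w" "integral\<^sup>L lborel w = 1"
  proof -
    have *: "w t = 2 / (pi * r) * (h t * sin (real 1 * t) * indicator {0..pi} t)" for t
      by (simp add: w_def)
    show "integrable lborel w"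
      unfolding *[abs_def] h_def
      by (intro integrable_mult_right sine_coefficient_integral(1)[OF abssum]) auto
    show "integral\<^sup>L lborel w = 1"
      unfolding *[abs_def] h_def integral_mult_right_zero
      by (subst sine_coefficient_integral(2)[OF abssum]) (use r a1 in auto)
  qed
  have wm [measurable]: "w \<in> borel_measurable lborel"
    using w1(1) by (rule borel_measurable_integrable)
  let ?D = "density lborel (\<lambda>t. ennreal (w t))"
  have "prob_space ?D"
  proof
    have "emeasure ?D (space ?D) = (\<integral>\<^sup>+t. ennreal (w t) \<partial>lborel)"
      by (subst emeasure_density) (auto simp: space_density)
    also have "\<dots> = 1"
      using nn_integral_eq_integral[OF w1(1)] w0 w1(2) by simp
    finally show "emeasure ?D (space ?D) = 1" .
  qed
  then interpret D: prob_space ?D .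
  let ?\<mu> = "distr ?D borel cos"
  have [measurable]: "q k \<in> borel_measurable borel" for k
    using q(2) by (intro borel_measurable_continuous_onI) auto
  show thesis
  proof
    show "real_distribution ?\<mu>"
      by (rule D.real_distribution_distr) simp
    show "AE x in ?\<mu>. x \<in> {-1..1}"
      by (subst AE_distr_iff) auto
    show "(LINT x|?\<mu>. q (Suc k) x) = a (Suc k) * r ^ k" for k
      using w(2)[of k] w0 by (simp add: integral_distr integral_density)
  qed
qed

text \<open>Nothing is assumed about \<open>g\<close> on the unit circle itself, so the measures
  come from smaller circles and a weak limit is taken as the radius tends to 1.\<close>

lemma typically_real_distribution:
  fixes a :: "nat \<Rightarrow> real" and g :: "complex \<Rightarrow> complex" and q :: "nat \<Rightarrow> real \<Rightarrow> real"
  assumes g: "\<And>u. norm u < 1 \<Longrightarrow> (\<lambda>k. of_real (a k) * u ^ k) sums g u"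
    and pos: "\<And>u. norm u < 1 \<Longrightarrow> Im u > 0 \<Longrightarrow> Im (g u) \<ge> 0"
    and a1: "a 1 = 1"
    and q: "\<And>k t. q k (cos t) * sin t = sin (k * t)" "\<And>k. continuous_on UNIV (q k)"
  obtains \<mu> where "real_distribution \<mu>" "AE x in \<mu>. x \<in> {-1..1}"
    "\<And>k. (LINT x|\<mu>. q (Suc k) x) = a (Suc k)"
proof -
  define r where "r n = 1 - 1 / (real n + 2)" for n
  have r: "0 < r n" "r n < 1" for n by (auto simp: r_def)
  have "\<exists>\<mu>. real_distribution \<mu> \<and> (AE x in \<mu>. x \<in> {-1..1}) \<and>
    (\<forall>k. (LINT x|\<mu>. q (Suc k) x) = a (Suc k) * r n ^ k)" for n
    by (rule typically_real_circle_distribution[OF g pos a1 q r[of n]], assumption+)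
       (intro exI conjI allI; (assumption | simp))
  then obtain \<mu> where \<mu>: "\<And>n. real_distribution (\<mu> n)" "\<And>n. AE x in \<mu> n. x \<in> {-1..1}"
    "\<And>n k. (LINT x|\<mu> n. q (Suc k) x) = a (Suc k) * r n ^ k"
    by metis
  obtain \<phi> M where M: "strict_mono (\<phi> :: nat \<Rightarrow> nat)" "real_distribution M" "AE x in M. x \<in> {-1..1}"
    and lim: "\<And>f :: real \<Rightarrow> real. continuous_on UNIV f \<Longrightarrow>
       (\<lambda>n. integral\<^sup>L (\<mu> (\<phi> n)) f) \<longlonglongrightarrow> integral\<^sup>L M f"
    by (rule bounded_support_weak_limit[of \<mu> "-1" 1, OF \<mu>(1,2)], simp) blast
  have "r \<longlonglongrightarrow> 1"
    unfolding r_def by real_asymp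
  then have "(\<lambda>n. a (Suc k) * (r \<circ> \<phi>) n ^ k) \<longlonglongrightarrow> a (Suc k) * 1 ^ k" for k
    by (intro tendsto_intros LIMSEQ_subseq_LIMSEQ M)
  moreover have "(\<lambda>n. a (Suc k) * (r \<circ> \<phi>) n ^ k) \<longlonglongrightarrow> integral\<^sup>L M (q (Suc k))" for k
    using lim[OF q(2), of "Suc k"] by (simp add: \<mu>(3))
  ultimately have "integral\<^sup>L M (q (Suc k)) = a (Suc k)" for k
    using LIMSEQ_unique by fastforce
  with that M show thesis by blast
qed

section \<open>Chebyshev moments and power moments\<close>

text \<open>The Taylor series of \<open>2 u / (1 + u^2)\<close>, the reciprocal of the Joukowski map
  \<open>(u + 1/u) / 2\<close>.\<close>

definition joukowski_fps :: "real fps" where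
  "joukowski_fps = 2 * fps_X * inverse (1 + fps_X ^ 2)"

lemma joukowski_fps_nth [simp]:
  "fps_nth joukowski_fps 0 = 0" "fps_nth joukowski_fps (Suc 0) = 2"
  by (simp_all add: joukowski_fps_def mult.assoc numeral_fps_const)

lemma joukowski_fps_mult: "joukowski_fps * (1 + fps_X ^ 2) = 2 * fps_X"
  unfolding joukowski_fps_def mult.assoc by (subst inverse_mult_eq_1) auto

text \<open>Expansion of \<open>X / (1 - t X)\<close>. Integrated in \<open>t\<close> against a
  measure it becomes \<open>X\<close> times the generating series of the moments.\<close>

definition cauchy_kernel_fps :: "real \<Rightarrow> real fps" where
  "cauchy_kernel_fps t = fps_X * Abs_fps (\<lambda>n. t ^ n)"

lemma cauchy_kernel_fps_mult: "cauchy_kernel_fps t * (1 - fps_const t * fps_X) = fps_X"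
proof -
  have "Abs_fps (\<lambda>n. t ^ n) * (1 - fps_const t * fps_X) = 1"
  proof (rule fps_ext)
    fix n show "fps_nth (Abs_fps (\<lambda>n. t ^ n) * (1 - fps_const t * fps_X)) n = fps_nth 1 n"
      by (cases n) (auto simp: right_diff_distrib mult.left_commute[of _ "fps_const t"] fps_X_mult_right_nth)
  qed
  then show ?thesis
    by (simp add: cauchy_kernel_fps_def mult.assoc)
qed

text \<open>\<open>cheb (k + 1)\<close> is the Chebyshev polynomial \<open>U\<^sub>k\<close> of the second kind: substituting
  \<open>2 X / (1 + X\<^sup>2)\<close> into \<open>X / (1 - t X)\<close> gives \<open>2 X / (1 - 2 t X + X\<^sup>2)\<close>.\<close>

definition cheb :: "nat \<Rightarrow> real \<Rightarrow> real" where
  "cheb k t = fps_nth (cauchy_kernel_fps t oo joukowski_fps) k / 2"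

lemma cauchy_kernel_fps_nth: "fps_nth (cauchy_kernel_fps t) n = (if n = 0 then 0 else t ^ (n - 1))"
  by (simp add: cauchy_kernel_fps_def)

lemma continuous_on_cheb: "continuous_on UNIV (cheb k)"
proof -
  have "continuous_on UNIV (\<lambda>t. if i = 0 then 0 else t ^ (i - 1) :: real)" for i
    by (cases "i = 0") (auto intro!: continuous_intros)
  then show ?thesis
    unfolding cheb_def fps_compose_nth cauchy_kernel_fps_nth by (intro continuous_intros) auto
qed

lemma cheb_rec: "cheb 0 t = 0" "cheb (Suc 0) t = 1" "cheb (Suc (Suc k)) t = 2 * t * cheb (Suc k) t - cheb k t"
proof -
  let ?W = joukowski_fps and ?X = "fps_X :: real fps"
  let ?K = "cauchy_kernel_fps t oo ?W"
  have "?K * (1 - fps_const t * ?W) = ?W"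
    using arg_cong[OF cauchy_kernel_fps_mult[of t], of "\<lambda>f. f oo ?W"]
    by (simp add: fps_compose_mult_distrib fps_compose_sub_distrib)
  \<comment> \<open>Multiplying by \<open>1 + X^2\<close> clears the denominators and gives
    \<open>K (1 - 2 t X + X^2) = 2 X\<close>; comparing coefficients is the recurrence.\<close>
  then have "?K * (1 - fps_const t * ?W) * (1 + ?X ^ 2) = ?W * (1 + ?X ^ 2)"
    by simp
  also have "?K * (1 - fps_const t * ?W) * (1 + ?X ^ 2) =
      ?K * ((1 + ?X ^ 2) - fps_const t * (?W * (1 + ?X ^ 2)))"
    by (simp add: algebra_simps)
  also have "\<dots> = ?K + ?K * ?X ^ 2 - fps_const (2 * t) * (?K * ?X)"
    unfolding joukowski_fps_mult by (simp add: algebra_simps numeral_fps_const flip: fps_const_mult)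
  also have "?W * (1 + ?X ^ 2) = fps_const 2 * ?X"
    by (simp add: joukowski_fps_mult numeral_fps_const)
  finally have eq: "fps_nth (?K + ?K * ?X ^ 2 - fps_const (2 * t) * (?K * ?X)) n = fps_nth (fps_const 2 * ?X) n" for n
    by simp
  show "cheb 0 t = 0" "cheb (Suc 0) t = 1"
    using eq[of 0] eq[of 1] by (simp_all add: cheb_def fps_X_power_mult_right_nth)
  show "cheb (Suc (Suc k)) t = 2 * t * cheb (Suc k) t - cheb k t"
    using eq[of "Suc (Suc k)"] by (simp add: cheb_def fps_X_power_mult_right_nth)
qed

lemma cheb_cos: "cheb k (cos t) * sin t = sin (k * t)"
proof -
  \<comment> \<open>The recurrence has order two, so the induction carries two consecutive
    indices.\<close>
  have "cheb k (cos t) * sin t = sin (k * t) \<and> cheb (Suc k) (cos t) * sin t = sin (Suc k * t)"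
  proof (induction k)
    case (Suc k)
    have "cheb (Suc (Suc k)) (cos t) * sin t = 2 * cos t * sin (Suc k * t) - sin (k * t)"
      using Suc by (simp add: cheb_rec left_diff_distrib mult.assoc)
    also have "sin (k * t) = sin (Suc k * t) * cos t - cos (Suc k * t) * sin t"
      unfolding sin_diff[symmetric] by (rule arg_cong[where f = sin]) (simp add: algebra_simps)
    also have "2 * cos t * sin (Suc k * t) - \<dots> = sin (Suc k * t + t)"
      by (simp add: sin_add)
    finally show ?case
      using Suc by (simp add: algebra_simps)
  qed (simp add: cheb_rec)
  then show ?thesis by blast
qed

lemma fps_compose_right_cancel:
  fixes f g h :: "'a :: field fps"
  assumes "fps_nth h 0 = 0" "fps_nth h 1 \<noteq> 0" "f oo h = g oo h"
  shows "f = g"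
proof -
  have "(k oo h) oo fps_inv h = k" for k :: "'a fps"
    using assms fps_inv_right[of h] fps_compose_assoc[of "fps_inv h" h k]
    by (simp add: fps_inv_def)
  with assms(3) show ?thesis by metis
qed

text \<open>Each coefficient of a composition involves finitely many moments, so integration
  commutes with substituting \<open>joukowski_fps\<close> into the kernel. The moment series of
  \<open>M\<close> and the series of \<open>s\<close> therefore agree after this substitution, and
  the invertible inner series cancels.\<close>

lemma moments_eq_if_cheb_moments:
  fixes s :: "nat \<Rightarrow> real"
  assumes M: "real_distribution M" and supp: "AE x in M. x \<in> {-1..1}"
    and cheb: "\<And>k. (LINT x|M. cheb (Suc k) x) = fps_nth ((fps_X * Abs_fps s) oo joukowski_fps) (Suc k) / 2"
  shows "integrable M (\<lambda>x. x ^ n)" and "(LINT x|M. x ^ n) = s n"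
proof -
  interpret real_distribution M by fact
  have int: "integrable M (\<lambda>x. x ^ n)" for n
    by (rule integrable_const_bound[of _ 1])
       (use supp in \<open>auto elim!: AE_mp intro!: power_le_one simp: power_abs\<close>)
  then show "integrable M (\<lambda>x. x ^ n)" .
  define m where "m n = (LINT x|M. x ^ n)" for n
  have "fps_nth ((fps_X * Abs_fps m) oo joukowski_fps) k = fps_nth ((fps_X * Abs_fps s) oo joukowski_fps) k" for k
  proof (cases k)
    case (Suc j)
    have int': "integrable M (\<lambda>x. fps_nth (cauchy_kernel_fps x) i)" for i
      using int by (cases i) (auto simp: cauchy_kernel_fps_nth)
    have "fps_nth (fps_X * Abs_fps m) i = (LINT x|M. fps_nth (cauchy_kernel_fps x) i)" for i
      by (simp add: cauchy_kernel_fps_nth m_def)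
    then have "fps_nth ((fps_X * Abs_fps m) oo joukowski_fps) k =
        (\<Sum>i=0..k. (LINT x|M. fps_nth (cauchy_kernel_fps x) i * fps_nth (joukowski_fps ^ i) k))"
      by (simp add: fps_compose_nth)
    also have "\<dots> = (LINT x|M. (\<Sum>i=0..k. fps_nth (cauchy_kernel_fps x) i * fps_nth (joukowski_fps ^ i) k))"
      by (rule Bochner_Integration.integral_sum[symmetric]) (intro integrable_mult_left int')
    also have "\<dots> = (LINT x|M. 2 * cheb k x)"
      by (simp add: cheb_def fps_compose_nth)
    also have "\<dots> = fps_nth ((fps_X * Abs_fps s) oo joukowski_fps) k"
      using cheb[of j] by (simp add: Suc)
    finally show ?thesis .
  qed simp
  then have "(fps_X * Abs_fps m) oo joukowski_fps = (fps_X * Abs_fps s) oo joukowski_fps"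
    by (rule fps_ext)
  then have "fps_X * Abs_fps m = fps_X * Abs_fps s"
    by (rule fps_compose_right_cancel[rotated 2]) simp_all
  from arg_cong[OF this, of "\<lambda>f. fps_nth f (Suc n)"] show "(LINT x|M. x ^ n) = s n"
    by (simp add: m_def)
qed

section \<open>Passage from the slit plane to the unit disc\<close>

lemma slit_unit_disc_map:
  fixes u :: complex
  assumes "norm u < 1"
  defines "v \<equiv> 2 * u / (1 + u ^ 2)"
  shows "1 + u ^ 2 \<noteq> 0" and "Im u > 0 \<Longrightarrow> Im v > 0" and "Im v = 0 \<Longrightarrow> \<bar>Re v\<bar> < 1"
proof -
  have "norm (u ^ 2) < 1"
    using assms(1) by (simp add: norm_power power_less_one_iff)
  then show nz: "1 + u ^ 2 \<noteq> 0"
    by (metis add_eq_0_iff norm_minus_cancel norm_one less_irrefl)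
  define c where "c = 2 / (norm (1 + u ^ 2)) ^ 2"
  have c: "c > 0" using nz by (simp add: c_def)
  have "v = of_real c * (u * cnj (1 + u ^ 2))"
    unfolding v_def c_def by (subst complex_div_cnj) (simp add: field_simps)
  \<comment> \<open>With the denominator made real, the imaginary part is a positive multiple of
    \<open>Im u * (1 - |u|^2)\<close>, so it has the sign of \<open>Im u\<close>.\<close>
  also have "u * cnj (1 + u ^ 2) = u + of_real ((norm u)\<^sup>2) * cnj u"
    unfolding complex_norm_square by (simp add: algebra_simps power2_eq_square)
  finally have v: "v = of_real c * (u + of_real ((norm u)\<^sup>2) * cnj u)" .
  have Im_v: "Im v = c * (Im u * (1 - (norm u)\<^sup>2))"
    unfolding v by (simp add: algebra_simps)
  have n: "1 - (norm u)\<^sup>2 > 0"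
    using assms(1) by (simp add: power_less_one_iff)
  show "Im v > 0" if "Im u > 0"
    unfolding Im_v using that c n by (intro mult_pos_pos)
  show "\<bar>Re v\<bar> < 1" if "Im v = 0"
  proof -
    have "Im u = 0" using that c n by (simp add: Im_v)
    then obtain x where x: "u = of_real x" by (metis complex_is_Real_iff Reals_cases)
    have "v = of_real (2 * x / (1 + x ^ 2))"
      by (simp add: v_def x)
    moreover have "(1 - \<bar>x\<bar>)\<^sup>2 > 0"
      using assms(1) by (simp add: x)
    then have "\<bar>2 * x\<bar> < 1 + x ^ 2"
      by (simp add: power2_diff)
    then have "\<bar>2 * x / (1 + x ^ 2)\<bar> < 1"
      by (simp add: abs_divide divide_less_eq_1 add_pos_nonneg)
    ultimately show ?thesis by simp
  qed
qed

lemma joukowski_has_fps_expansion: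
  "(\<lambda>u :: complex. 2 * u / (1 + u ^ 2)) has_fps_expansion fps_complex joukowski_fps"
proof -
  let ?W = "2 * fps_X * inverse (1 + fps_X ^ 2) :: complex fps"
  have "?W * (1 + fps_X ^ 2) = 2 * fps_X"
    unfolding mult.assoc by (subst inverse_mult_eq_1) auto
  also have "\<dots> = fps_complex (2 * fps_X)"
    by (rule fps_ext) (simp add: numeral_fps_const)
  also have "\<dots> = fps_complex joukowski_fps * fps_complex (1 + fps_X ^ 2)"
    by (simp flip: joukowski_fps_mult fps_complex_mult)
  also have "fps_complex (1 + fps_X ^ 2) = 1 + fps_X ^ 2"
    by (rule fps_ext) (simp add: fps_X_power_nth)
  finally have "?W = fps_complex joukowski_fps"
    by (rule mult_right_cancel[THEN iffD1, rotated]) (auto simp: fps_eq_iff intro!: exI[of _ 0])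
  moreover have "(\<lambda>u :: complex. 2 * u * inverse (1 + u ^ 2)) has_fps_expansion ?W"
    by (intro fps_expansion_intros) auto
  ultimately show ?thesis
    by (simp add: divide_inverse)
qed

text \<open>The composite of \<open>f\<close> with the disc map is holomorphic on the whole unit
  disc, so its Taylor series converges there and not merely near 0; its coefficients are the
  prescribed Chebyshev moments.\<close>

lemma slit_plane_moments_unit:
  fixes f :: "complex \<Rightarrow> complex" and s :: "nat \<Rightarrow> real"
  assumes hol: "f holomorphic_on {z. Im z = 0 \<longrightarrow> \<bar>Re z\<bar> < 1}"
    and exp: "f has_fps_expansion fps_complex (fps_X * Abs_fps s)"
    and s0: "s 0 = 1"
    and pos: "\<And>z. Im z > 0 \<Longrightarrow> Im (f z) \<ge> 0"
  obtains M where "real_distribution M" "\<And>n. integrable M (\<lambda>x. x ^ n)"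
    "\<And>n. (LINT x|M. x ^ n) = s n"
proof -
  let ?J = "\<lambda>u :: complex. 2 * u / (1 + u ^ 2)"
  define G where "G = (fps_X * Abs_fps s) oo joukowski_fps"
  \<comment> \<open>Halving offsets the linear coefficient 2 of \<open>joukowski_fps\<close>, so
    that \<open>a 1 = s 0\<close>, the total mass 1.\<close>
  define a where "a k = fps_nth G k / 2" for k
  define g where "g u = f (?J u) / 2" for u
  have "(\<lambda>u. f (?J u)) holomorphic_on ball 0 1"
    by (intro holomorphic_on_compose_gen[OF _ hol, unfolded o_def] holomorphic_intros)
       (use slit_unit_disc_map in auto)
  then have g_hol: "g holomorphic_on eball 0 1"
    unfolding g_def[abs_def] one_ereal_def by (auto intro!: holomorphic_intros)
  have "(f \<circ> ?J) has_fps_expansion fps_complex G"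
    unfolding G_def fps_complex_compose
    by (intro has_fps_expansion_compose exp joukowski_has_fps_expansion) auto
  then have "(\<lambda>u. (1 / 2) * f (?J u)) has_fps_expansion fps_const (1 / 2) * fps_complex G"
    unfolding o_def by (intro fps_expansion_intros)
  then have g_exp: "g has_fps_expansion fps_const (1 / 2) * fps_complex G"
    by (simp add: g_def[abs_def])
  have sums: "(\<lambda>k. of_real (a k) * u ^ k) sums g u" if "norm u < 1" for u
    using has_fps_expansion_imp_sums_complex[OF g_exp g_hol, of u] that
    by (simp add: a_def)
  have nonneg: "Im (g u) \<ge> 0" if "norm u < 1" "Im u > 0" for u
    using pos[of "?J u"] slit_unit_disc_map(2)[OF that] by (simp add: g_def)
  have a1: "a 1 = 1"
    using s0 by (simp add: a_def G_def fps_compose_nth)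
  obtain M where M: "real_distribution M" "AE x in M. x \<in> {-1..1}"
    "\<And>k. (LINT x|M. cheb (Suc k) x) = a (Suc k)"
    by (rule typically_real_distribution[OF sums nonneg a1 cheb_cos continuous_on_cheb], assumption+) blast
  from moments_eq_if_cheb_moments[OF M(1,2), of s] M(3) that[OF M(1)] show thesis
    by (simp add: a_def G_def)
qed

text \<open>Passing to \<open>f (\<rho> z) / \<rho>\<close> multiplies \<open>s n\<close> by
  \<open>\<rho> ^ n\<close> and keeps \<open>s 0\<close>; pushing the measure forward under division
  by \<open>\<rho>\<close> undoes this.\<close>

lemma slit_plane_positive_definite:
  fixes f :: "complex \<Rightarrow> complex" and s :: "nat \<Rightarrow> real"
  assumes hol: "f holomorphic_on {z. Im z = 0 \<longrightarrow> \<bar>Re z\<bar> < \<rho>}" and "\<rho> > 0"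
    and exp: "f has_fps_expansion fps_X * Abs_fps (\<lambda>n. of_real (s n))"
    and s0: "s 0 = 1"
    and pos: "\<And>z. Im z > 0 \<Longrightarrow> Im (f z) \<ge> 0"
  shows "positive_definite_seq s"
proof -
  let ?f = "\<lambda>z. f (of_real \<rho> * z) / of_real \<rho>"
  have "(\<lambda>z. f (of_real \<rho> * z)) holomorphic_on {z. Im z = 0 \<longrightarrow> \<bar>Re z\<bar> < 1}"
    using \<open>\<rho> > 0\<close>
    by (intro holomorphic_on_compose_gen[OF _ hol, unfolded o_def] holomorphic_intros)
       (auto simp: abs_mult)
  then have 1: "?f holomorphic_on {z. Im z = 0 \<longrightarrow> \<bar>Re z\<bar> < 1}"
    using \<open>\<rho> > 0\<close> by (auto intro!: holomorphic_intros)
  have "(\<lambda>z :: complex. of_real \<rho> * z) has_fps_expansion fps_const (of_real \<rho>) * fps_X"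
    by (intro fps_expansion_intros)
  then have "(f \<circ> (\<lambda>z. of_real \<rho> * z)) has_fps_expansion
      ((fps_X * Abs_fps (\<lambda>n. of_real (s n))) oo (fps_const (of_real \<rho>) * fps_X))"
    by (intro has_fps_expansion_compose exp) auto
  then have "(\<lambda>z. inverse (of_real \<rho>) * f (of_real \<rho> * z)) has_fps_expansion
      fps_const (inverse (of_real \<rho>)) * ((fps_X * Abs_fps (\<lambda>n. of_real (s n))) oo (fps_const (of_real \<rho>) * fps_X))"
    unfolding o_def by (intro fps_expansion_intros)
  also have "fps_const (inverse (of_real \<rho>)) * ((fps_X * Abs_fps (\<lambda>n. of_real (s n))) oo (fps_const (of_real \<rho>) * fps_X))
      = fps_complex (fps_X * Abs_fps (\<lambda>n. \<rho> ^ n * s n))"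
    using \<open>\<rho> > 0\<close> unfolding fps_compose_linear
    by (auto simp: fps_eq_iff gr0_conv_Suc field_simps)
  finally have 2: "?f has_fps_expansion fps_complex (fps_X * Abs_fps (\<lambda>n. \<rho> ^ n * s n))"
    by (simp add: divide_inverse mult.commute)
  obtain M where M: "real_distribution M" "\<And>n. integrable M (\<lambda>x. x ^ n)"
    "\<And>n. (LINT x|M. x ^ n) = \<rho> ^ n * s n"
    by (rule slit_plane_moments_unit[OF 1 2]) (use s0 pos \<open>\<rho> > 0\<close> in auto)
  interpret real_distribution M by fact
  let ?N = "distr M borel (\<lambda>x. x / \<rho>)"
  have "real_distribution ?N"
    by (rule real_distribution_distr) simp
  moreover have "integrable ?N (\<lambda>x. x ^ n)" for n
    using M(2)[of n] by (subst integrable_distr_eq) (auto simp: power_divide)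
  moreover have "s n = (LINT x|?N. x ^ n)" for n
    using M(3)[of n] \<open>\<rho> > 0\<close> by (subst integral_distr) (auto simp: power_divide)
  ultimately show ?thesis
    unfolding positive_definite_seq_def by blast
qed

section \<open>Analytic continuation of the inverse function\<close>

text \<open>Over the complex numbers a square-free polynomial is a constant times a product of
  distinct linear factors.\<close>

lemma card_roots_rsquarefree:
  fixes p :: "complex poly"
  assumes "rsquarefree p"
  shows "finite {z. poly p z = 0}" "card {z. poly p z = 0} = degree p"
proof -
  have p: "p \<noteq> 0" using assms by (simp add: rsquarefree_def)
  then show "finite {z. poly p z = 0}" by (rule poly_roots_finite)
  have "degree p = degree (\<Prod>z|poly p z = 0. [:-z, 1:])"
    using p arg_cong[OF complex_poly_decompose_rsquarefree[OF assms], of degree] by simp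
  also have "\<dots> = card {z. poly p z = 0}"
    by (subst degree_prod_eq_sum_degree) auto
  finally show "card {z. poly p z = 0} = degree p" by simp
qed

text \<open>The pencil \<open>A - z B\<close> has the same number of roots for every \<open>z\<close> in \<open>S\<close>, so the local branches
  around the preimages of one point account for all nearby preimages.\<close>

lemma rational_covering_space:
  fixes A B :: "complex poly" and S :: "complex set"
  defines "F \<equiv> \<lambda>w. poly A w / poly B w"
  defines "C \<equiv> {w. poly B w \<noteq> 0 \<and> F w \<in> S}"
  assumes S: "open S"
    and sf: "\<And>z. z \<in> S \<Longrightarrow> rsquarefree (A - smult z B)"
    and deg: "\<And>z. z \<in> S \<Longrightarrow> degree (A - smult z B) = N" and "N > 0"
    and cop: "\<And>z w. z \<in> S \<Longrightarrow> poly (A - smult z B) w = 0 \<Longrightarrow> poly B w \<noteq> 0"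
  shows "open C" and "F holomorphic_on C" and "covering_space C F S"
proof -
  define U where "U = {w. poly B w \<noteq> 0}"
  have U: "open U"
    unfolding U_def by (intro open_Collect_neq continuous_intros)
  have FU: "F holomorphic_on U"
    unfolding F_def U_def by (intro holomorphic_intros) auto
  have C_eq: "C = U \<inter> F -` S"
    by (auto simp: C_def U_def)
  show C: "open C"
    unfolding C_eq using U S holomorphic_on_imp_continuous_on[OF FU] by (metis continuous_open_preimage)
  show FC: "F holomorphic_on C"
    by (rule holomorphic_on_subset[OF FU]) (auto simp: C_eq)
  \<comment> \<open>By \<open>cop\<close> no root of the pencil is a zero of \<open>B\<close>, so
    \<open>R z\<close> is exactly the fibre of \<open>F\<close> over \<open>z\<close>.\<close>
  define R where "R z = {w. poly (A - smult z B) w = 0}" for z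
  have R: "finite (R z)" "card (R z) = N" "w \<in> R z \<longleftrightarrow> w \<in> C \<and> F w = z" if "z \<in> S" for z w
    using card_roots_rsquarefree[OF sf[OF that]] deg[OF that] cop[OF that, of w] that
    by (auto simp: R_def C_def F_def field_simps)
  \<comment> \<open>A critical point \<open>w\<close> of \<open>F\<close> in \<open>C\<close> would
    be a multiple root of the pencil at \<open>z = F w\<close>.\<close>
  have dF: "deriv F w \<noteq> 0" if "w \<in> C" for w
  proof
    assume 0: "deriv F w = 0"
    have B: "poly B w \<noteq> 0" and z: "F w \<in> S" using that by (auto simp: C_def)
    have "(F has_field_derivative
        (poly (pderiv A) w * poly B w - poly A w * poly (pderiv B) w) / (poly B w * poly B w)) (at w)"
      unfolding F_def using B by (intro derivative_eq_intros poly_DERIV | simp)+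
    with 0 B have "poly (pderiv A) w * poly B w = poly A w * poly (pderiv B) w"
      by (auto dest!: DERIV_imp_deriv)
    with B have "poly (pderiv (A - smult (F w) B)) w = 0"
      by (simp add: pderiv_diff pderiv_smult F_def field_simps)
    moreover have "poly (A - smult (F w) B) w = 0"
      using B by (simp add: F_def)
    ultimately show False
      using sf[OF z] by (simp add: rsquarefree_roots)
  qed
  show "covering_space C F S"
  proof (rule covering_spaceI)
    show "continuous_on C F"
      by (rule holomorphic_on_imp_continuous_on[OF FC])
    show "F ` C = S"
    proof
      show "S \<subseteq> F ` C"
      proof
        fix z assume z: "z \<in> S"
        have "R z \<noteq> {}" using R(2)[OF z] \<open>N > 0\<close> by auto
        then obtain w where "w \<in> R z" by blast
        with R(3)[OF z, of w] show "z \<in> F ` C" by auto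
      qed
    qed (auto simp: C_def)
    fix z0 assume z0: "z0 \<in> S"
    obtain d where d: "\<And>w. d w > 0" "\<And>w w'. w' \<in> R z0 \<Longrightarrow> w' \<noteq> w \<Longrightarrow> d w \<le> dist w w'"
      using finite_set_avoid[OF R(1)[OF z0]] by metis
    have "\<exists>r>0. ball w r \<subseteq> C \<and> inj_on F (ball w r)" if "w \<in> R z0" for w
      using has_complex_derivative_locally_injective[OF FC _ C dF] R(3)[OF z0, of w] that by metis
    then obtain r where r: "\<And>w. w \<in> R z0 \<Longrightarrow> r w > 0 \<and> ball w (r w) \<subseteq> C \<and> inj_on F (ball w (r w))"
      by metis
    \<comment> \<open>With radius at most half the distance to the other roots, the balls are
      disjoint; \<open>F\<close> is injective on each.\<close>
    define V where "V w = ball w (min (r w) (d w / 2))" for w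
    have V: "open (V w)" "w \<in> V w" "V w \<subseteq> C" "inj_on F (V w)" if "w \<in> R z0" for w
      using r[OF that] d(1)[of w] by (auto simp: V_def intro: inj_on_subset)
    have disj: "V w \<inter> V w' = {}" if "w \<in> R z0" "w' \<in> R z0" "w \<noteq> w'" for w w'
      using d(2)[of w w'] d(2)[of w' w] that unfolding V_def by (intro disjoint_ballI) (auto simp: dist_commute)
    have opF: "open (F ` V w)" if "w \<in> R z0" for w
      by (rule open_mapping_thm3[OF holomorphic_on_subset[OF FC]]) (use V[OF that] in auto)
    \<comment> \<open>The fibre is finite, so \<open>T\<close> is open; each sheet
      \<open>W w\<close> below maps onto all of \<open>T\<close>.\<close>
    define T where "T = S \<inter> (\<Inter>w\<in>R z0. F ` V w)"
    have T: "open T" "z0 \<in> T" "T \<subseteq> S"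
      unfolding T_def using S R[OF z0] opF V(2) z0 by (auto intro!: open_INT open_Int) 
    define W where "W w = V w \<inter> F -` T" for w
    have W_open: "open (W w)" if "w \<in> R z0" for w
      unfolding W_def using V[OF that] T
      by (meson FC continuous_on_subset continuous_open_preimage holomorphic_on_imp_continuous_on)
    have W_im: "F ` W w = T" if "w \<in> R z0" for w
    proof
      show "T \<subseteq> F ` W w"
      proof
        fix x assume x: "x \<in> T"
        with that obtain y where "y \<in> V w" "x = F y" by (auto simp: T_def)
        with x show "x \<in> F ` W w" by (auto simp: W_def)
      qed
    qed (auto simp: W_def)
    have "(\<Union>w\<in>R z0. W w) = C \<inter> F -` T"
    proof
      show "C \<inter> F -` T \<subseteq> (\<Union>w\<in>R z0. W w)"
      proof
        fix x assume x: "x \<in> C \<inter> F -` T"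
        define z where "z = F x"
        have z: "z \<in> T" "z \<in> S" using x T by (auto simp: z_def)
        \<comment> \<open>One preimage of \<open>z\<close> in each of the disjoint sheets gives
          \<open>N\<close> distinct points, as many as the whole fibre contains, so \<open>x\<close>
          is among them.\<close>
        have "\<exists>y\<in>W w. F y = z" if "w \<in> R z0" for w
          using W_im[OF that] z by blast
        then obtain y where y: "\<And>w. w \<in> R z0 \<Longrightarrow> y w \<in> W w \<and> F (y w) = z"
          by metis
        have "inj_on y (R z0)"
        proof (rule inj_onI)
          fix a b assume "a \<in> R z0" "b \<in> R z0" "y a = y b"
          then show "a = b"
            using y[of a] y[of b] disj[of a b] by (auto simp: W_def)
        qed
        then have "card (y ` R z0) = card (R z)"
          using R(2) z z0 by (simp add: card_image)
        moreover have "y ` R z0 \<subseteq> R z"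
        proof
          fix v assume "v \<in> y ` R z0"
          then obtain w where "w \<in> R z0" "v = y w" by blast
          then show "v \<in> R z"
            using y[of w] V(3)[of w] by (auto simp: W_def R(3)[OF z(2)])
        qed
        ultimately have "y ` R z0 = R z"
          using R(1)[OF z(2)] by (simp add: card_subset_eq)
        moreover have "x \<in> R z"
          using x R(3)[OF z(2)] by (simp add: z_def)
        ultimately obtain w where "w \<in> R z0" "x = y w" by (metis imageE)
        with y[of w] show "x \<in> (\<Union>w\<in>R z0. W w)" by auto
      qed
    qed (use V in \<open>auto simp: W_def\<close>)
    moreover have "pairwise disjnt (W ` R z0)"
      using disj by (auto simp: pairwise_def disjnt_def W_def)
    moreover have "\<exists>q. homeomorphism (W w) T F q" if "w \<in> R z0" for w
    proof -
      have "continuous_on (W w) F" "inj_on F (W w)"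
        using V[OF that] holomorphic_on_imp_continuous_on[OF FC]
        by (auto simp: W_def intro: continuous_on_subset inj_on_subset)
      then show ?thesis
        using Further_Topology.invariance_of_domain_homeomorphism[OF W_open[OF that], of F] W_im[OF that] by auto
    qed
    ultimately show "\<exists>T. z0 \<in> T \<and> openin (top_of_set S) T \<and>
        (\<exists>v. \<Union>v = C \<inter> F -` T \<and> (\<forall>u\<in>v. openin (top_of_set C) u) \<and> pairwise disjnt v \<and>
             (\<forall>u\<in>v. \<exists>q. homeomorphism u T F q))"
      using T W_open V(3)
      by (intro exI[of _ T] conjI exI[of _ "W ` R z0"])
         (auto simp: openin_open_eq[OF S] openin_open_eq[OF C] W_def)
  qed
qed

section \<open>Real polynomials and their pencils at complex points\<close>

lemma cpoly_add: "cpoly (p + q) w = cpoly p w + cpoly q w"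
proof -
  have "map_poly complex_of_real (p + q) = map_poly of_real p + map_poly of_real q"
    by (rule poly_eqI) (simp add: coeff_map_poly)
  then show ?thesis by simp
qed

lemma cpoly_diff: "cpoly (p - q) w = cpoly p w - cpoly q w"
proof -
  have "map_poly complex_of_real (p - q) = map_poly of_real p - map_poly of_real q"
    by (rule poly_eqI) (simp add: coeff_map_poly)
  then show ?thesis by simp
qed

lemma cpoly_mult: "cpoly (p * q) w = cpoly p w * cpoly q w"
proof -
  have "map_poly complex_of_real (p * q) = map_poly of_real p * map_poly of_real q"
    by (rule poly_eqI) (simp add: coeff_map_poly coeff_mult)
  then show ?thesis by simp
qed

lemma cpoly_of_real: "cpoly p (of_real x) = of_real (poly p x)"
  by (induction p) (auto simp: map_poly_pCons)

lemma pderiv_map_poly_of_real: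
  "pderiv (map_poly complex_of_real p) = map_poly of_real (pderiv p)"
  by (rule poly_eqI) (simp add: coeff_map_poly coeff_pderiv)

lemma cpoly_chi:
  "cpoly (chi P Q) w = (cpoly P w + w * cpoly (pderiv P) w) * cpoly Q w - w * cpoly P w * cpoly (pderiv Q) w"
  by (simp add: chi_def cpoly_add cpoly_diff cpoly_mult map_poly_pCons)

text \<open>The hypotheses say that \<open>X P - z Q\<close> and its derivative vanish at
  \<open>w\<close>. Substituting them turns \<open>chi\<close> into
  \<open>z Q' Q - z Q Q'\<close>.\<close>

lemma chi_root_if_double_root:
  assumes "w * cpoly P w = z * cpoly Q w"
    and "cpoly P w + w * cpoly (pderiv P) w = z * cpoly (pderiv Q) w"
  shows "cpoly (chi P Q) w = 0"
  unfolding cpoly_chi assms by (simp add: mult_ac)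

text \<open>A Bezout identity over the reals persists at complex arguments, so real coprimality also
  excludes common complex roots.\<close>

lemma coprime_cpoly_no_common_root:
  assumes "coprime P Q" "cpoly P w = 0" "cpoly Q w = 0"
  shows False
proof -
  obtain a b where "a * P + b * Q = 1"
    using bezout_coefficients_fst_snd[of P Q] assms(1) by (metis coprime_iff_gcd_eq_1)
  then have "cpoly (a * P + b * Q) w = 1" by simp
  then show False using assms(2,3) by (simp add: cpoly_add cpoly_mult)
qed

text \<open>For real \<open>a\<close>, \<open>b\<close> and non-real \<open>z\<close>,
  \<open>a - z b\<close> vanishes only if \<open>a = b = 0\<close>, so leading terms cannot cancel.
  The degree is thus constant on the upper half-plane, as a constant number of sheets
  demands.\<close>

lemma degree_pencil:
  fixes p q :: "real poly"
  assumes "Im z \<noteq> 0"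
  shows "degree (map_poly of_real p - smult z (map_poly of_real q)) = max (degree p) (degree q)"
proof (rule antisym)
  let ?N = "max (degree p) (degree q)"
  show "degree (map_poly of_real p - smult z (map_poly of_real q)) \<le> ?N"
    by (rule degree_diff_le) (auto simp: degree_map_poly intro: le_trans[OF degree_smult_le])
  show "?N \<le> degree (map_poly of_real p - smult z (map_poly of_real q))"
  proof (cases "?N = 0")
    case False
    have "coeff (map_poly of_real p - smult z (map_poly of_real q)) ?N =
        of_real (coeff p ?N) - z * of_real (coeff q ?N)"
      by (simp add: coeff_map_poly)
    moreover have "of_real (coeff p ?N) - z * of_real (coeff q ?N) \<noteq> 0"
    proof
      assume "of_real (coeff p ?N) - z * of_real (coeff q ?N) = 0"
      then have "Im (of_real (coeff p ?N) - z * of_real (coeff q ?N)) = 0"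
        "Re (of_real (coeff p ?N) - z * of_real (coeff q ?N)) = 0"
        by simp_all
      with assms have "coeff q ?N = 0" "coeff p ?N = 0" by auto
      with False show False
        by (cases "degree p \<le> degree q") (auto simp: max_def split: if_splits)
    qed
    ultimately show ?thesis by (metis le_degree)
  qed simp
qed

text \<open>A multiple root of the pencil at \<open>z\<close> is a root of \<open>chi\<close>, hence
  a real number \<open>x\<close>. Then \<open>x P(x) = z Q(x)\<close> with non-real \<open>z\<close>
  forces \<open>Q(x) = 0\<close>, which is incompatible with coprimality.\<close>

lemma inverse_branch_upper_halfplane:
  fixes P Q :: "real poly"
  defines "F \<equiv> \<lambda>w. w * cpoly P w / cpoly Q w" and "S \<equiv> {z. Im z > 0}"
  assumes adm: "admissible P Q"
    and real_roots: "\<And>w. cpoly (chi P Q) w = 0 \<Longrightarrow> w \<in> \<real>"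
  obtains C where "open C" "F holomorphic_on C" "covering_space C F S"
    "C = {w. cpoly Q w \<noteq> 0 \<and> F w \<in> S}"
proof -
  define A B where "A = map_poly complex_of_real (pCons 0 P)" and "B = map_poly complex_of_real Q"
  have F: "F = (\<lambda>w. poly A w / poly B w)"
    by (simp add: F_def A_def B_def map_poly_pCons)
  have dA: "poly (pderiv A) w = cpoly P w + w * cpoly (pderiv P) w" for w
    by (simp add: A_def map_poly_pCons pderiv_pCons pderiv_map_poly_of_real)
  have dB: "poly (pderiv B) w = cpoly (pderiv Q) w" for w
    by (simp add: B_def pderiv_map_poly_of_real)
  \<comment> \<open>A common zero \<open>w\<close> would satisfy \<open>w P(w) = 0 = Q(w)\<close>,
    and \<open>w\<close> is not 0 because \<open>Q(0) = 1\<close>.\<close>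
  have cop: "poly B w \<noteq> 0" if "poly (A - smult z B) w = 0" for z w
  proof
    assume 0: "poly B w = 0"
    with that have "w * cpoly P w = 0" by (simp add: A_def map_poly_pCons)
    moreover have "w \<noteq> 0"
      using 0 adm cpoly_of_real[of Q 0] by (auto simp: B_def admissible_def)
    ultimately show False
      using 0 adm coprime_cpoly_no_common_root[of P Q w] by (simp add: B_def admissible_def)
  qed
  have sf: "rsquarefree (A - smult z B)" if z: "z \<in> S" for z
    unfolding rsquarefree_roots
  proof safe
    fix w assume 1: "poly (A - smult z B) w = 0" and 2: "poly (pderiv (A - smult z B)) w = 0"
    have eq: "w * cpoly P w = z * cpoly Q w"
      using 1 by (simp add: A_def B_def map_poly_pCons)
    moreover have "cpoly P w + w * cpoly (pderiv P) w = z * cpoly (pderiv Q) w"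
      using 2 by (simp add: pderiv_diff pderiv_smult dA dB)
    ultimately have "w \<in> \<real>"
      by (intro real_roots chi_root_if_double_root)
    then obtain x where x: "w = of_real x" by (elim Reals_cases)
    from eq have "of_real (x * poly P x) = z * of_real (poly Q x)"
      unfolding x cpoly_of_real by simp
    from arg_cong[OF this, of Im] z have "poly Q x = 0"
      by (simp add: S_def)
    with cop[OF 1] show False
      by (simp add: B_def x cpoly_of_real)
  qed
  have deg: "degree (A - smult z B) = max (degree (pCons 0 P)) (degree Q)" if "z \<in> S" for z
    unfolding A_def B_def using that by (intro degree_pencil) (auto simp: S_def)
  have "P \<noteq> 0" using adm by (auto simp: admissible_def)
  then have N: "max (degree (pCons 0 P)) (degree Q) > 0" by simp
  have "open S" by (simp add: S_def open_halfspace_Im_gt)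
  note * = rational_covering_space[where S = S and A = A and B = B, OF this _ deg N]
  have "open C \<and> F holomorphic_on C \<and> covering_space C F S"
    if "C = {w. cpoly Q w \<noteq> 0 \<and> F w \<in> S}" for C
    unfolding that F B_def[symmetric] by (intro conjI *; (assumption | erule sf | erule cop))
  then show thesis
    using that by blast
qed

section \<open>The local inverse and its extension to the slit plane\<close>

lemma rational_local_inverse:
  fixes P Q :: "real poly"
  defines "F \<equiv> \<lambda>w. w * cpoly P w / cpoly Q w"
  assumes adm: "admissible P Q"
  obtains D \<delta> where "\<delta> > 0" "D holomorphic_on ball 0 \<delta>" "D 0 = 0" "deriv D 0 = 1"
    "\<And>z. z \<in> ball 0 \<delta> \<Longrightarrow> cpoly Q (D z) \<noteq> 0 \<and> F (D z) = z"
proof -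
  define U where "U = {w. cpoly Q w \<noteq> 0}"
  have P0: "cpoly P 0 = 1" and Q0: "cpoly Q 0 = 1"
    using adm cpoly_of_real[of P 0] cpoly_of_real[of Q 0] by (auto simp: admissible_def)
  have U: "open U" "0 \<in> U"
    unfolding U_def by (auto intro!: open_Collect_neq continuous_intros simp: Q0)
  have FU: "F holomorphic_on U"
    unfolding F_def U_def by (intro holomorphic_intros) auto
  have "(F has_field_derivative 1) (at 0)"
    unfolding F_def using P0 Q0 by (auto intro!: derivative_eq_intros poly_DERIV)
  then have dF: "deriv F 0 = 1" by (rule DERIV_imp_deriv)
  obtain r where r: "r > 0" "ball 0 r \<subseteq> U" "open (F ` ball 0 r)" "inj_on F (ball 0 r)"
    using has_complex_derivative_locally_invertible[OF FU U(2,1)] dF by auto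
  obtain D where D: "D holomorphic_on (F ` ball 0 r)"
    "\<And>z. z \<in> ball 0 r \<Longrightarrow> deriv F z * deriv D (F z) = 1" "\<And>z. z \<in> ball 0 r \<Longrightarrow> D (F z) = z"
    using holomorphic_has_inverse[OF holomorphic_on_subset[OF FU r(2)] open_ball r(4)] by metis
  have F0: "F 0 = 0" by (simp add: F_def)
  then have "0 \<in> F ` ball 0 r" using r(1) by (metis centre_in_ball imageI)
  then obtain \<delta> where \<delta>: "\<delta> > 0" "ball 0 \<delta> \<subseteq> F ` ball 0 r"
    using r(3) open_contains_ball by blast
  have inv: "cpoly Q (D z) \<noteq> 0 \<and> F (D z) = z" if "z \<in> ball 0 \<delta>" for z
  proof -
    have "z \<in> F ` ball 0 r" using that \<delta>(2) by (rule subsetD[rotated])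
    then obtain w where "w \<in> ball 0 r" "z = F w" by (elim imageE)
    then show ?thesis using D(3)[of w] r(2) by (auto simp: U_def)
  qed
  show thesis
  proof (rule that[OF \<delta>(1) holomorphic_on_subset[OF D(1) \<delta>(2)] _ _ inv])
    show "D 0 = 0" "deriv D 0 = 1"
      using D(2)[of 0] D(3)[of 0] dF F0 r(1) by simp_all
  qed
qed

text \<open>Real Taylor coefficients make the series commute with conjugation; this is the symmetry
  behind the reflection.\<close>

lemma real_expansion_cnj:
  assumes exp: "f has_fps_expansion fps_complex G" and hol: "f holomorphic_on ball 0 \<delta>"
    and z: "norm z < \<delta>"
  shows "cnj (f (cnj z)) = f z"
proof -
  have sums: "(\<lambda>n. of_real (fps_nth G n) * u ^ n) sums f u" if "norm u < \<delta>" for u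
    using has_fps_expansion_imp_sums_complex[OF exp, of "ereal \<delta>" u] hol that by simp
  have "(\<lambda>n. of_real (fps_nth G n) * z ^ n) sums cnj (f (cnj z))"
    using sums[of "cnj z"] z by (subst sums_cnj[symmetric]) simp
  with sums[OF z] show ?thesis using sums_unique2 by blast
qed

text \<open>Lifting the identity through the covering gives an inverse branch \<open>L\<close> on
  the upper half-plane. It agrees with the local inverse \<open>D\<close> on the half-disc, and
  \<open>D\<close> bridges the real interval across which \<open>L\<close> is reflected.\<close>

lemma inverse_extends_to_slit_plane:
  fixes P Q :: "real poly"
  assumes adm: "admissible P Q"
    and real_roots: "\<And>w. cpoly (chi P Q) w = 0 \<Longrightarrow> w \<in> \<real>"
  obtains f \<delta> where "\<delta> > 0" "f holomorphic_on {z. Im z = 0 \<longrightarrow> \<bar>Re z\<bar> < \<delta>}"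
    "f has_fps_expansion fps_X * Abs_fps (\<lambda>n. of_real (s_seq P Q n))"
    "\<And>z. Im z > 0 \<Longrightarrow> Im (f z) \<ge> 0"
proof -
  define F where "F w = w * cpoly P w / cpoly Q w" for w
  define S where "S = {z. Im z > 0}"
  obtain C where C: "open C" "F holomorphic_on C" "covering_space C F S"
    "C = {w. cpoly Q w \<noteq> 0 \<and> F w \<in> S}"
    using inverse_branch_upper_halfplane[OF adm real_roots] unfolding F_def S_def by blast
  obtain D \<delta> where \<delta>: "\<delta> > 0" and D: "D holomorphic_on ball 0 \<delta>" "D 0 = 0" "deriv D 0 = 1"
    and FD: "\<And>z. z \<in> ball 0 \<delta> \<Longrightarrow> cpoly Q (D z) \<noteq> 0 \<and> F (D z) = z"
    by (rule rational_local_inverse[OF adm, folded F_def]) blast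
  have S: "open S" "convex S"
    by (simp_all add: S_def open_halfspace_Im_gt convex_halfspace_Im_gt)
  have in_C: "D z \<in> C" if "z \<in> S \<inter> ball 0 \<delta>" for z
    using FD[of z] that C(4) by auto
  have exp: "D has_fps_expansion fps_X * Abs_fps (\<lambda>n. of_real (s_seq P Q n))"
  proof (rule s_seq_analytic_inverse[OF adm])
    show "D 0 = 0" by (rule D(2))
    show "D analytic_on {0}"
      using D(1) \<delta> by (meson analytic_at open_ball centre_in_ball)
    have "\<forall>\<^sub>F z in nhds 0. z \<in> ball (0 :: complex) \<delta>"
      using \<delta> by (intro eventually_nhds_in_open) auto
    then show "\<forall>\<^sub>F z in nhds 0. D z * cpoly P (D z) / cpoly Q (D z) = z"
      by eventually_elim (use FD in \<open>auto simp: F_def\<close>)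
  qed
  have exp': "D has_fps_expansion fps_complex (fps_X * Abs_fps (s_seq P Q))"
    using exp by (simp add: fps_complex_mult) (simp add: fps_complex_def)
  have cnj_D: "cnj (D (cnj z)) = D z" if "norm z < \<delta>" for z
    by (rule real_expansion_cnj[OF exp' D(1) that])

  \<comment> \<open>A base point in the upper half-disc: prescribing \<open>L z1 = D z1\<close>
    selects the branch that continues \<open>D\<close>.\<close>
  define z1 where "z1 = \<i> * of_real (\<delta> / 2)"
  have z1: "z1 \<in> S \<inter> ball 0 \<delta>"
    using \<delta> by (simp add: z1_def S_def norm_mult)
  obtain L where L: "continuous_on S L" "L \<in> S \<rightarrow> C" "L z1 = D z1" "\<And>z. z \<in> S \<Longrightarrow> F (L z) = z"
  proof (rule covering_space_lift_strong[OF C(3) in_C[OF z1], of z1 S "\<lambda>z. z"])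
    show "simply_connected S" by (rule convex_imp_simply_connected[OF S(2)])
    show "locally path_connected S" by (rule open_imp_locally_path_connected[OF S(1)])
  qed (use z1 FD in auto)
  have L_hol: "L holomorphic_on S"
    by (rule covering_space_lift_is_holomorphic[OF C(3,1,2), of "\<lambda>z. z"])
       (use L in \<open>auto intro: holomorphic_intros\<close>)
  have D_cont: "continuous_on (ball 0 \<delta>) D"
    by (rule holomorphic_on_imp_continuous_on[OF D(1)])
  \<comment> \<open>Both functions lift the identity on the connected half-disc and agree at
    \<open>z1\<close>.\<close>
  have LD: "L z = D z" if "z \<in> S \<inter> ball 0 \<delta>" for z
  proof (rule covering_space_lift_unique[where c = C and p = F and S = S and ?g1.0 = L and ?g2.0 = D
        and a = z1 and T = "S \<inter> ball 0 \<delta>" and f = "\<lambda>z. z"])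
    show "connected (S \<inter> ball 0 \<delta>)"
      by (intro convex_connected convex_Int S convex_ball)
    show "continuous_on (S \<inter> ball 0 \<delta>) L" "continuous_on (S \<inter> ball 0 \<delta>) D"
      by (rule continuous_on_subset[OF L(1)] continuous_on_subset[OF D_cont]; simp)+
  qed (use L FD in_C z1 that C(3) in auto)

  have "Im (L z) > 0" if z: "z \<in> S" for z
  proof -
    \<comment> \<open>A real value of \<open>L\<close> would make \<open>F (L z) = z\<close> real;
      where the denominator vanishes the quotient is 0 by convention, still real.\<close>
    have nz: "Im (L z) \<noteq> 0" if z: "z \<in> S" for z
    proof
      assume "Im (L z) = 0"
      then obtain x where "L z = of_real x"
        by (metis complex_is_Real_iff Reals_cases)
      then have "F (L z) = of_real (x * poly P x / poly Q x)"
        by (simp add: F_def cpoly_of_real)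
      with L(4)[OF z] z show False by (auto simp: S_def)
    qed
    have "(D has_field_derivative 1) (at 0)"
      using holomorphic_derivI[OF D(1), of 0 UNIV] \<delta> D(3) by simp
    then have "((\<lambda>w. D w / w) \<longlongrightarrow> 1) (at 0)"
      using D(2) by (simp add: has_field_derivative_iff)
    from tendsto_Re[OF this] have "\<forall>\<^sub>F w in at 0. Re (D w / w) > 0"
      by (rule order_tendstoD) simp
    then obtain e where e: "e > 0" "\<And>w. w \<noteq> 0 \<Longrightarrow> norm w < e \<Longrightarrow> Re (D w / w) > 0"
      unfolding eventually_at by auto
    define t where "t = min e \<delta> / 2"
    have t: "t > 0" "t < e" "t < \<delta>" using e(1) \<delta> by (auto simp: t_def)
    \<comment> \<open>On the imaginary axis \<open>Re (D z2 / z2)\<close> is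
      \<open>Im (D z2) / t\<close>. As \<open>D w / w\<close> tends to 1 at 0, this fixes the sign
      of \<open>Im (L z2)\<close>.\<close>
    define z2 where "z2 = \<i> * of_real t"
    have z2: "z2 \<in> S \<inter> ball 0 \<delta>" using t by (simp add: z2_def S_def norm_mult)
    have "Re (D z2 / z2) > 0"
      using t by (intro e(2)) (auto simp: z2_def norm_mult)
    moreover have "D z2 / z2 = - \<i> * D z2 / of_real t"
      using t by (simp add: z2_def field_simps)
    ultimately have "Im (L z2) > 0"
      using t LD[OF z2] by (simp add: zero_less_divide_iff)
    \<comment> \<open>\<open>Im (L z)\<close> has no zero on the connected half-plane and is
      positive at \<open>z2\<close>, so it cannot change sign.\<close>
    show ?thesis
    proof (rule ccontr)
      assume "\<not> Im (L z) > 0"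
      moreover have "connected ((\<lambda>z. Im (L z)) ` S)"
        by (intro connected_continuous_image continuous_intros L convex_connected S)
      ultimately have "0 \<in> (\<lambda>z. Im (L z)) ` S"
        using \<open>Im (L z2) > 0\<close> z z2 connectedD_interval[of _ "Im (L z)" "Im (L z2)" 0] by auto
      with nz show False by auto
    qed
  qed
  note L_pos = this

  define \<Omega> where "\<Omega> = {z. Im z = 0 \<longrightarrow> \<bar>Re z\<bar> < \<delta>}"
  have real_in_ball: "z \<in> ball 0 \<delta>" if "z \<in> \<Omega>" "Im z = 0" for z
    using that by (simp add: \<Omega>_def cmod_eq_Re)
  have ball_sub: "ball 0 \<delta> \<subseteq> \<Omega>"
    by (auto simp: \<Omega>_def intro: le_less_trans[OF abs_Re_le_cmod])
  \<comment> \<open>The closed upper part of the slit plane consists of the open half-plane and of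
    real points in the ball, so values of \<open>D\<close> outside the ball do not affect the
    reflection there.\<close>
  define h where "h z = (if Im z > 0 then L z else D z)" for z
  have h_D: "h z = D z" if "z \<in> ball 0 \<delta>" for z
    using LD[of z] that by (auto simp: h_def S_def)
  define f where "f z = (if 0 \<le> Im z then h z else cnj (h (cnj z)))" for z
  have f_D: "f z = D z" if "z \<in> ball 0 \<delta>" for z
    using that cnj_D[of z] h_D[of z] h_D[of "cnj z"] by (auto simp: f_def)
  have "f holomorphic_on \<Omega>"
    unfolding f_def[abs_def]
  proof (rule Schwarz_reflection)
    have "z \<in> \<Omega> \<longleftrightarrow> z \<in> {z. Im z > 0} \<union> {z. Im z < 0} \<union> ball 0 \<delta>" for z
      using real_in_ball[of z] ball_sub
      by (cases "Im z" "0 :: real" rule: linorder_cases) (auto simp: \<Omega>_def)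
    then have "\<Omega> = {z. Im z > 0} \<union> {z. Im z < 0} \<union> ball 0 \<delta>" by blast
    then show "open \<Omega>"
      by (metis open_Un open_ball open_halfspace_Im_gt open_halfspace_Im_lt)
    show "cnj ` \<Omega> \<subseteq> \<Omega>" by (auto simp: \<Omega>_def)
    have "h holomorphic_on S"
      using L_hol by (rule holomorphic_transform) (auto simp: h_def S_def)
    then show "h holomorphic_on \<Omega> \<inter> {z. 0 < Im z}"
      by (rule holomorphic_on_subset) (auto simp: S_def)
    from \<open>h holomorphic_on S\<close> have "continuous_on S h"
      by (rule holomorphic_on_imp_continuous_on)
    \<comment> \<open>On the ball \<open>h\<close> is just \<open>D\<close>, which gives continuity
      up to the real segment; the two open pieces are then glued.\<close>
    moreover have "continuous_on (ball 0 \<delta>) h"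
      using D_cont by (rule continuous_on_eq) (simp add: h_D)
    ultimately have "continuous_on (S \<union> ball 0 \<delta>) h"
      using S(1) by (intro continuous_on_open_Un) auto
    then show "continuous_on (\<Omega> \<inter> {z. 0 \<le> Im z}) h"
      by (rule continuous_on_subset) (use real_in_ball in \<open>force simp: S_def\<close>)
    show "h z \<in> \<real>" if "z \<in> \<Omega>" "z \<in> \<real>" for z
    proof -
      have "z \<in> ball 0 \<delta>" "cnj z = z"
        using that real_in_ball by (auto simp: complex_is_Real_iff complex_eq_iff)
      then show ?thesis
        using cnj_D[of z] h_D[of z] by (simp add: Reals_cnj_iff)
    qed
  qed
  moreover have "f has_fps_expansion fps_X * Abs_fps (\<lambda>n. of_real (s_seq P Q n))"
  proof -
    have "\<forall>\<^sub>F z in nhds 0. z \<in> ball (0 :: complex) \<delta>"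
      using \<delta> by (intro eventually_nhds_in_open) auto
    then have "\<forall>\<^sub>F z in nhds 0. f z = D z"
      by eventually_elim (rule f_D)
    with exp show ?thesis
      by (subst has_fps_expansion_cong) auto
  qed
  moreover have "Im (f z) \<ge> 0" if "Im z > 0" for z
    using L_pos[of z] that by (simp add: f_def h_def S_def)
  ultimately show thesis
    using that[OF \<delta>] unfolding \<Omega>_def by blast
qed

theorem proposition2p7:
  fixes P Q :: "real poly"
  assumes "admissible P Q"
  shows "(\<forall>w0 z0 :: complex.
            w0 * cpoly P w0 = z0 * cpoly Q w0 \<longrightarrow>
            cpoly P w0 + w0 * cpoly (pderiv P) w0 = z0 * cpoly (pderiv Q) w0 \<longrightarrow>
            cpoly (chi P Q) w0 = 0) \<and>
         ((\<forall>w :: complex. cpoly (chi P Q) w = 0 \<longrightarrow> w \<in> \<real>) \<longrightarrow>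
            positive_definite_seq (s_seq P Q))"
proof (intro conjI allI impI)
  fix w0 z0 :: complex
  assume "w0 * cpoly P w0 = z0 * cpoly Q w0"
    and "cpoly P w0 + w0 * cpoly (pderiv P) w0 = z0 * cpoly (pderiv Q) w0"
  then show "cpoly (chi P Q) w0 = 0"
    by (rule chi_root_if_double_root)
next
  assume "\<forall>w :: complex. cpoly (chi P Q) w = 0 \<longrightarrow> w \<in> \<real>"
  then obtain f \<delta> where f: "\<delta> > 0" "f holomorphic_on {z. Im z = 0 \<longrightarrow> \<bar>Re z\<bar> < \<delta>}"
    "f has_fps_expansion fps_X * Abs_fps (\<lambda>n. of_real (s_seq P Q n))"
    "\<And>z. Im z > 0 \<Longrightarrow> Im (f z) \<ge> 0"
    using inverse_extends_to_slit_plane[OF assms] by blast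
  from slit_plane_positive_definite[OF f(2,1,3) s_seq_inverse(2)[OF assms] f(4)]
  show "positive_definite_seq (s_seq P Q)" .
qed

end
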